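(* For every integer $r>0$, there exists an $r$-strong eulerian digraph $D$ which has no strong $2$-partition; that is, there is no partition $(V_1,V_2)$ of $V(D)$ such that $B_D(V_1,V_2)$ is strongly connected.
   Context: For a partition $(V_1,V_2)$ of $V(D)$, $B_D(V_1,V_2)$ is the spanning subdigraph of $D$ whose arcs are those arcs of $D$ with one end in $V_1$ and the other in $V_2$. A digraph is strong (strongly connected) if for every ordered pair $u,v$ of distinct vertices there is a directed $(u,v)$-path; it is $r$-strong if $D-S$ is strong for every set $S$ of fewer than $r$ vertices. A digraph is eulerian if it is connected and every vertex has in-degree equal to its out-degree. *)

theory Defs
  imports "Graph_Theory.Digraph_Component"
begin

text \<open>The bound on the number of vertices is the usual convention for \<open>r\<close>-strong connectivity;
  it excludes degenerate digraphs and ensures that some vertex is left after deleting \<open>S\<close>.\<close>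

definition r_strong :: "nat \<Rightarrow> ('a, 'b) pre_digraph \<Rightarrow> bool" where
  "r_strong r D \<longleftrightarrow>
     r < card (verts D) \<and>
     (\<forall>S. S \<subseteq> verts D \<and> card S < r \<longrightarrow> strongly_connected (D \<restriction> (verts D - S)))"

definition eulerian :: "('a, 'b) pre_digraph \<Rightarrow> bool" where
  "eulerian D \<longleftrightarrow> connected D \<and> (\<forall>v \<in> verts D. in_degree D v = out_degree D v)"

definition bipartite_subdigraph ::
  "('a, 'b) pre_digraph \<Rightarrow> 'a set \<Rightarrow> 'a set \<Rightarrow> ('a, 'b) pre_digraph" where
  "bipartite_subdigraph D V1 V2 =
     \<lparr> verts = verts D,
       arcs = {e \<in> arcs D. tail D e \<in> V1 \<and> head D e \<in> V2 \<or> tail D e \<in> V2 \<and> head D e \<in> V1},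
       tail = tail D,
       head = head D \<rparr>"

text \<open>Empty parts need not be excluded: if one part is empty, the bipartite subdigraph has no arcs,
  so it is not strong as soon as there are at least two vertices.\<close>

definition strong_2_partition :: "('a, 'b) pre_digraph \<Rightarrow> 'a set \<Rightarrow> 'a set \<Rightarrow> bool" where
  "strong_2_partition D V1 V2 \<longleftrightarrow>
     V1 \<union> V2 = verts D \<and> V1 \<inter> V2 = {} \<and> strongly_connected (bipartite_subdigraph D V1 V2)"

end

theory Submission
  imports Defs "HOL-Library.Nat_Bijection" "HOL-Library.Disjoint_Sets"
begin

text \<open>Take \<open>2 r - 1\<close> points; call every \<open>r\<close>-subset \<open>e\<close> of them a block. To each block \<open>e\<close> attach a hub
  and, for each \<open>i \<in> e\<close>, a port \<open>(e, i)\<close>. The points of \<open>e\<close> dominate the hub, the hub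
  dominates the ports, every port dominates all points of \<open>e\<close>, and a point \<open>x \<in> e\<close> dominates the ports
  \<open>(e, i)\<close> with \<open>i \<noteq> x\<close>.

  In a strong bipartite spanning subdigraph every vertex has an in-neighbour and an out-neighbour of
  the other colour. Some block is monochromatic. Its points are the only out-neighbours of its ports, so
  these all have the other colour; then the in-neighbours (points) of the hub all have one colour and
  its out-neighbours (ports) the other one, and the hub cannot be coloured.

  The digraph is eulerian because the arc from \<open>x\<close> to the hub of \<open>e\<close> compensates for the missing arc
  from \<open>x\<close> to \<open>(e, x)\<close>. It is \<open>r\<close>-strong because the \<open>r\<close> ports of a block give \<open>r\<close> internally
  disjoint paths between any two of its points, the one through \<open>(e, x)\<close> using the hub.\<close>

section \<open>The digraph\<close>

text \<open>The first component is a tag (0 for points, 1 for hubs, 2 for ports) that keeps the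
  three kinds of vertices apart inside the single type \<open>nat\<close>.\<close>

definition point :: "nat \<Rightarrow> nat" where
  "point x = prod_encode (0, x)"

definition hub :: "nat \<Rightarrow> nat" where
  "hub e = prod_encode (1, e)"

definition port :: "nat \<Rightarrow> nat \<Rightarrow> nat" where
  "port e i = prod_encode (2, prod_encode (e, i))"

lemma vertex_eq_iff [simp]:
  "point x = point y \<longleftrightarrow> x = y"
  "hub e = hub f \<longleftrightarrow> e = f"
  "port e i = port f j \<longleftrightarrow> e = f \<and> i = j"
  "point x \<noteq> hub e" "hub e \<noteq> point x"
  "point x \<noteq> port e i" "port e i \<noteq> point x"
  "hub e \<noteq> port f i" "port f i \<noteq> hub e"
  by (auto simp: point_def hub_def port_def)

text \<open>Blocks are represented by their codes under \<^const>\<open>set_encode\<close>.\<close>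

definition blocks :: "nat \<Rightarrow> nat set" where
  "blocks r = {e. set_decode e \<subseteq> {..<2 * r - 1} \<and> card (set_decode e) = r}"

definition block_verts :: "nat \<Rightarrow> nat set" where
  "block_verts r = point ` {..<2 * r - 1} \<union> hub ` blocks r \<union>
     {port e i | e i. e \<in> blocks r \<and> i \<in> set_decode e}"

definition block_arcs :: "nat \<Rightarrow> (nat \<times> nat) set" where
  "block_arcs r =
     {(point x, hub e) | e x. e \<in> blocks r \<and> x \<in> set_decode e} \<union>
     {(hub e, port e i) | e i. e \<in> blocks r \<and> i \<in> set_decode e} \<union>
     {(port e i, point x) | e i x. e \<in> blocks r \<and> i \<in> set_decode e \<and> x \<in> set_decode e} \<union>
     {(point x, port e i) | e i x. e \<in> blocks r \<and> i \<in> set_decode e \<and> x \<in> set_decode e \<and> x \<noteq> i}"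

text \<open>Each arc is the pair of its own ends, which rules out parallel arcs.\<close>

definition block_digraph :: "nat \<Rightarrow> (nat, nat \<times> nat) pre_digraph" where
  "block_digraph r = \<lparr>verts = block_verts r, arcs = block_arcs r, tail = fst, head = snd\<rparr>"

lemma block_digraph_simps [simp]:
  "verts (block_digraph r) = block_verts r"
  "arcs (block_digraph r) = block_arcs r"
  "tail (block_digraph r) = fst"
  "head (block_digraph r) = snd"
  by (simp_all add: block_digraph_def)

section \<open>Finiteness and existence of blocks\<close>

lemma blocks_subset: "e \<in> blocks r \<Longrightarrow> x \<in> set_decode e \<Longrightarrow> x < 2 * r - 1"
  by (auto simp: blocks_def)

lemma card_block: "e \<in> blocks r \<Longrightarrow> card (set_decode e) = r"
  by (simp add: blocks_def)

lemma finite_blocks: "finite (blocks r)"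
proof -
  have "e \<in> set_encode ` Pow {..<2 * r - 1}" if "e \<in> blocks r" for e
    using that image_eqI [of e set_encode "set_decode e"] by (simp add: blocks_def)
  then have "blocks r \<subseteq> set_encode ` Pow {..<2 * r - 1}"
    by blast
  then show ?thesis
    by (rule finite_subset) simp
qed

text \<open>Supplies a block through two given points (\<open>A = {x, y}\<close>) and a block inside
  a large colour class (\<open>A = {}\<close>).\<close>

lemma ex_block:
  assumes "A \<subseteq> B" "B \<subseteq> {..<2 * r - 1}" "card A \<le> r" "r \<le> card B"
  shows "\<exists>e\<in>blocks r. A \<subseteq> set_decode e \<and> set_decode e \<subseteq> B"
proof -
  have fin: "finite B"
    using assms(2) by (rule finite_subset) simp
  obtain C where C: "A \<subseteq> C" "C \<subseteq> B" "card C = r"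
    using exists_subset_between [OF assms(3,4,1) fin] by blast
  have "set_decode (set_encode C) = C"
    using C fin by (meson finite_subset set_encode_inverse)
  then show ?thesis
    using C assms(2) by (intro bexI [of _ "set_encode C"]) (auto simp: blocks_def)
qed

section \<open>Vertex set and well-formedness\<close>

lemma verts_intros [intro]:
  "x < 2 * r - 1 \<Longrightarrow> point x \<in> block_verts r"
  "e \<in> blocks r \<Longrightarrow> x \<in> set_decode e \<Longrightarrow> point x \<in> block_verts r"
  "e \<in> blocks r \<Longrightarrow> hub e \<in> block_verts r"
  "e \<in> blocks r \<Longrightarrow> i \<in> set_decode e \<Longrightarrow> port e i \<in> block_verts r"
  by (auto simp: block_verts_def dest: blocks_subset)

lemma verts_cases:
  assumes "v \<in> block_verts r"
  obtains (point) x where "v = point x" "x < 2 * r - 1"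
  | (hub) e where "v = hub e" "e \<in> blocks r"
  | (port) e i where "v = port e i" "e \<in> blocks r" "i \<in> set_decode e"
  using assms by (auto simp: block_verts_def)

lemma finite_block_verts: "finite (block_verts r)"
proof -
  have "{port e i | e i. e \<in> blocks r \<and> i \<in> set_decode e} =
      (\<lambda>(e, i). port e i) ` (SIGMA e:blocks r. set_decode e)"
    by auto
  then show ?thesis
    by (simp add: block_verts_def finite_blocks)
qed

lemma block_arcs_subset: "block_arcs r \<subseteq> block_verts r \<times> block_verts r"
  by (auto simp: block_arcs_def)

lemma digraph_block_digraph: "digraph (block_digraph r)"
proof
  show "finite (arcs (block_digraph r))"
    using finite_subset [OF block_arcs_subset] finite_block_verts by simp
  show "tail (block_digraph r) a \<noteq> head (block_digraph r) a" if "a \<in> arcs (block_digraph r)" for a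
    using that by (auto simp: block_arcs_def)
qed (use block_arcs_subset [of r] in \<open>auto simp: finite_block_verts arc_to_ends_def\<close>)

section \<open>Degrees\<close>

text \<open>For each kind of vertex, the in-arcs and the out-arcs are injective images of one and
  the same index set.\<close>

lemma in_degree_eq_out_degree:
  assumes "v \<in> block_verts r"
  shows "in_degree (block_digraph r) v = out_degree (block_digraph r) v"
  using assms
proof (cases rule: verts_cases)
  case (point x)
  define P where "P = {(e, i). e \<in> blocks r \<and> x \<in> set_decode e \<and> i \<in> set_decode e}"
  have "in_arcs (block_digraph r) v = (\<lambda>(e, i). (port e i, point x)) ` P"
    using point by (auto simp: in_arcs_def block_arcs_def P_def)
  \<comment> \<open>The index \<open>i = x\<close>, for which the port arc is missing, is taken by
    the arc to the hub.\<close>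
  moreover have "out_arcs (block_digraph r) v =
      (\<lambda>(e, i). (point x, if i = x then hub e else port e i)) ` P" (is "_ = ?f ` P")
  proof (intro equalityI subsetI)
    fix a
    assume "a \<in> out_arcs (block_digraph r) v"
    then consider (hub) e where "e \<in> blocks r" "x \<in> set_decode e" "a = (point x, hub e)"
      | (port) e i where "e \<in> blocks r" "x \<in> set_decode e" "i \<in> set_decode e" "i \<noteq> x"
          "a = (point x, port e i)"
      using point by (auto simp: out_arcs_def block_arcs_def)
    then show "a \<in> ?f ` P"
    proof cases
      case hub
      then show ?thesis
        by (intro image_eqI [of _ _ "(e, x)"]) (auto simp: P_def)
    next
      case port
      then show ?thesis
        by (intro image_eqI [of _ _ "(e, i)"]) (auto simp: P_def)
    qed
  qed (use point in \<open>auto simp: out_arcs_def block_arcs_def P_def split: if_splits\<close>)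
  moreover have "inj_on (\<lambda>(e, i). (port e i, point x)) P"
    by (auto simp: inj_on_def)
  moreover have "inj_on (\<lambda>(e, i). (point x, if i = x then hub e else port e i)) P"
    by (auto simp: inj_on_def split: if_splits)
  ultimately show ?thesis
    by (simp add: in_degree_def out_degree_def card_image)
next
  case (hub e)
  have "in_arcs (block_digraph r) v = (\<lambda>x. (point x, hub e)) ` set_decode e"
    using hub by (auto simp: in_arcs_def block_arcs_def)
  moreover have "out_arcs (block_digraph r) v = (\<lambda>i. (hub e, port e i)) ` set_decode e"
    using hub by (auto simp: out_arcs_def block_arcs_def)
  ultimately show ?thesis
    by (simp add: in_degree_def out_degree_def card_image inj_on_def)
next
  case (port e i)
  \<comment> \<open>Dually, the arc from the hub stands in for the missing arc from
    \<open>point i\<close>.\<close>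
  have "in_arcs (block_digraph r) v =
      (\<lambda>x. (if x = i then hub e else point x, port e i)) ` set_decode e" (is "_ = ?f ` _")
  proof (intro equalityI subsetI)
    fix a
    assume "a \<in> in_arcs (block_digraph r) v"
    then consider "a = (hub e, port e i)"
      | x where "x \<in> set_decode e" "x \<noteq> i" "a = (point x, port e i)"
      using port by (auto simp: in_arcs_def block_arcs_def)
    then show "a \<in> ?f ` set_decode e"
    proof cases
      case 1
      then show ?thesis
        using port(3) by (intro image_eqI [of _ _ i]) simp_all
    next
      case (2 x)
      then show ?thesis
        by (intro image_eqI [of _ _ x]) simp_all
    qed
  next
    fix a
    assume "a \<in> ?f ` set_decode e"
    then obtain x where "x \<in> set_decode e" "a = ?f x"
      by blast
    then show "a \<in> in_arcs (block_digraph r) v"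
      using port by (cases "x = i") (simp_all add: in_arcs_def block_arcs_def)
  qed
  moreover have "out_arcs (block_digraph r) v = (\<lambda>x. (port e i, point x)) ` set_decode e"
    using port by (auto simp: out_arcs_def block_arcs_def)
  moreover have "inj_on (\<lambda>x. (if x = i then hub e else point x, port e i)) (set_decode e)"
    by (auto simp: inj_on_def split: if_splits)
  ultimately show ?thesis
    by (simp add: in_degree_def out_degree_def card_image inj_on_def)
qed

section \<open>Connectivity\<close>

text \<open>Pigeonhole: if \<open>S\<close> met every \<open>P j\<close>, choosing a common element
  for each \<open>j\<close> would inject \<open>J\<close> into \<open>S\<close>.\<close>

lemma ex_disjoint_member:
  assumes "disjoint_family_on P J" "finite S" "card S < card J"
  obtains j where "j \<in> J" "P j \<inter> S = {}"
proof (rule ccontr)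
  assume "\<not> thesis"
  then have "\<forall>j\<in>J. \<exists>s. s \<in> P j \<inter> S"
    using that by blast
  then obtain f where f: "\<And>j. j \<in> J \<Longrightarrow> f j \<in> P j \<inter> S"
    by metis
  have "inj_on f J"
    using f assms(1) by (fastforce simp: inj_on_def disjoint_family_on_def)
  then have "card J \<le> card S"
    using f assms(2) by (intro card_inj_on_le [of f]) auto
  then show False
    using assms(3) by simp
qed

text \<open>The \<open>2 * r - 1\<close> points and one hub already give \<open>2 * r\<close>
  vertices.\<close>

lemma card_block_verts:
  assumes "r > 0"
  shows "r < card (block_verts r)"
proof -
  obtain e where e: "e \<in> blocks r"
    using assms ex_block [of "{}" "{..<2 * r - 1}" r] by fastforce
  have "card (insert (hub e) (point ` {..<2 * r - 1})) = 2 * r"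
    using assms by (subst card_insert_disjoint) (auto simp: card_image inj_on_def)
  moreover have "card (insert (hub e) (point ` {..<2 * r - 1})) \<le> card (block_verts r)"
    using e by (intro card_mono finite_block_verts) auto
  ultimately show ?thesis
    using assms by linarith
qed

text \<open>Every surviving vertex reaches some surviving point and is reached from one; surviving
  points reach each other through the ports of a common block.\<close>

lemma strongly_connected_delete:
  assumes S: "S \<subseteq> block_verts r" "card S < r"
  shows "strongly_connected (block_digraph r \<restriction> (block_verts r - S))"
proof -
  interpret D: digraph "block_digraph r"
    by (rule digraph_block_digraph)
  define H where "H = block_digraph r \<restriction> (block_verts r - S)"
  interpret H: wf_digraph H
    unfolding H_def by (rule D.wellformed_induce_subgraph)
  have verts_H [simp]: "verts H = block_verts r - S"
    by (simp add: H_def)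
  have finS: "finite S"
    using S(1) finite_block_verts by (rule finite_subset)
  have adj: "u \<rightarrow>\<^sup>*\<^bsub>H\<^esub> v" if "(u, v) \<in> block_arcs r" "u \<notin> S" "v \<notin> S" for u v
  proof -
    have "(u, v) \<in> arcs_ends H"
      using that block_arcs_subset [of r]
      by (force simp: H_def arcs_ends_conv image_iff)
    then show ?thesis
      by (rule H.reachable_adjI)
  qed

  \<comment> \<open>A block has \<open>r\<close> elements and \<open>S\<close> has fewer, so among
    disjoint sets indexed by the block one avoids \<open>S\<close>.\<close>
  have free: "\<exists>j\<in>set_decode e. P j \<inter> S = {}"
    if "e \<in> blocks r" "disjoint_family_on P (set_decode e)" for e P
    using ex_disjoint_member [OF that(2) finS] S(2) card_block [OF that(1)] by metis

  have to_point: "port e i \<rightarrow>\<^sup>*\<^bsub>H\<^esub> point x"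
    if "e \<in> blocks r" "i \<in> set_decode e" "x \<in> set_decode e" "port e i \<notin> S" "point x \<notin> S" for e i x
    using that by (intro adj) (auto simp: block_arcs_def)

  have point_port: "point x \<rightarrow>\<^sup>*\<^bsub>H\<^esub> port e i"
    if e: "e \<in> blocks r" "x \<in> set_decode e" "i \<in> set_decode e" and notin: "point x \<notin> S" "port e i \<notin> S"
      and hub: "i = x \<Longrightarrow> hub e \<notin> S" for e x i
  proof (cases "i = x")
    case True
    have "point x \<rightarrow>\<^sup>*\<^bsub>H\<^esub> hub e"
      using e notin hub True by (intro adj) (auto simp: block_arcs_def)
    also have "hub e \<rightarrow>\<^sup>*\<^bsub>H\<^esub> port e i"
      using e notin hub True by (intro adj) (auto simp: block_arcs_def)
    finally show ?thesis .
  next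
    case False
    then show ?thesis
      using e notin by (intro adj) (auto simp: block_arcs_def)
  qed

  have same_block: "point x \<rightarrow>\<^sup>*\<^bsub>H\<^esub> point y"
    if e: "e \<in> blocks r" "x \<in> set_decode e" "y \<in> set_decode e" and notin: "point x \<notin> S" "point y \<notin> S"
    for e x y
  proof -
    \<comment> \<open>The route through \<open>port e x\<close> also needs the hub; no other route
      uses it, so the family stays disjoint.\<close>
    have "disjoint_family_on (\<lambda>i. if i = x then {port e i, hub e} else {port e i}) (set_decode e)"
      by (auto simp: disjoint_family_on_def)
    from free [OF e(1) this] obtain i where i: "i \<in> set_decode e"
        "(if i = x then {port e i, hub e} else {port e i}) \<inter> S = {}"
      by blast
    have "point x \<rightarrow>\<^sup>*\<^bsub>H\<^esub> port e i"
      using e notin i by (intro point_port) (auto split: if_splits)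
    also have "port e i \<rightarrow>\<^sup>*\<^bsub>H\<^esub> point y"
      using e notin i by (intro to_point) (auto split: if_splits)
    finally show ?thesis .
  qed

  have points: "point x \<rightarrow>\<^sup>*\<^bsub>H\<^esub> point y"
    if xy: "x < 2 * r - 1" "y < 2 * r - 1" and notin: "point x \<notin> S" "point y \<notin> S" for x y
  proof -
    \<comment> \<open>Two distinct points require \<open>2 * r - 1 \<ge> 2\<close>, hence
      \<open>r \<ge> 2\<close>.\<close>
    have "card {x, y} \<le> r"
      using xy by (cases "x = y") auto
    then obtain e where "e \<in> blocks r" "{x, y} \<subseteq> set_decode e"
      using xy ex_block [of "{x, y}" "{..<2 * r - 1}" r] by fastforce
    then show ?thesis
      using notin same_block by auto
  qed

  have from_vertex: "\<exists>x. x < 2 * r - 1 \<and> point x \<notin> S \<and> v \<rightarrow>\<^sup>*\<^bsub>H\<^esub> point x"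
    if v: "v \<in> block_verts r" "v \<notin> S" for v
    using v(1)
  proof (cases rule: verts_cases)
    case (point x)
    then show ?thesis
      using v by auto
  next
    case (hub e)
    obtain i where i: "i \<in> set_decode e" "port e i \<notin> S"
      using free [OF hub(2), of "\<lambda>i. {port e i}"] by (auto simp: disjoint_family_on_def)
    obtain x where x: "x \<in> set_decode e" "point x \<notin> S"
      using free [OF hub(2), of "\<lambda>x. {point x}"] by (auto simp: disjoint_family_on_def)
    have "v \<rightarrow>\<^sup>*\<^bsub>H\<^esub> port e i"
      using hub v i by (intro adj) (auto simp: block_arcs_def)
    also have "port e i \<rightarrow>\<^sup>*\<^bsub>H\<^esub> point x"
      using hub i x by (intro to_point)
    finally show ?thesis
      using x hub blocks_subset by blast
  next
    case (port e i)
    obtain x where x: "x \<in> set_decode e" "point x \<notin> S"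
      using free [OF port(2), of "\<lambda>x. {point x}"] by (auto simp: disjoint_family_on_def)
    then show ?thesis
      using port v to_point blocks_subset by blast
  qed

  have to_vertex: "\<exists>x. x < 2 * r - 1 \<and> point x \<notin> S \<and> point x \<rightarrow>\<^sup>*\<^bsub>H\<^esub> v"
    if v: "v \<in> block_verts r" "v \<notin> S" for v
    using v(1)
  proof (cases rule: verts_cases)
    case (point x)
    then show ?thesis
      using v by auto
  next
    case (hub e)
    obtain x where x: "x \<in> set_decode e" "point x \<notin> S"
      using free [OF hub(2), of "\<lambda>x. {point x}"] by (auto simp: disjoint_family_on_def)
    have "point x \<rightarrow>\<^sup>*\<^bsub>H\<^esub> v"
      using hub v x by (intro adj) (auto simp: block_arcs_def)
    then show ?thesis
      using x hub blocks_subset by blast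
  next
    case (port e i)
    \<comment> \<open>Only \<open>point i\<close> must pass through the hub to reach
      \<open>port e i\<close>.\<close>
    have "disjoint_family_on (\<lambda>x. if x = i then {point x, hub e} else {point x}) (set_decode e)"
      by (auto simp: disjoint_family_on_def)
    from free [OF port(2) this] obtain x where x: "x \<in> set_decode e"
        "(if x = i then {point x, hub e} else {point x}) \<inter> S = {}"
      by blast
    have "point x \<rightarrow>\<^sup>*\<^bsub>H\<^esub> v"
      unfolding port(1) using port v x by (intro point_port) (auto split: if_splits)
    moreover have "point x \<notin> S"
      using x by (auto split: if_splits)
    ultimately show ?thesis
      using x port blocks_subset by blast
  qed

  have "strongly_connected H"
  proof (rule strongly_connectedI)
    \<comment> \<open>Fewer than \<open>r\<close> deletions cannot exhaust more than
      \<open>r\<close> vertices; \<open>card S < r\<close> also forces \<open>r > 0\<close>.\<close>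
    have "r < card (block_verts r)"
      using S(2) by (intro card_block_verts) simp
    then show "verts H \<noteq> {}"
      using S(2) card_mono [OF finS, of "block_verts r"] by auto
  next
    fix u v
    assume "u \<in> verts H" "v \<in> verts H"
    then obtain x y where x: "x < 2 * r - 1" "point x \<notin> S" "u \<rightarrow>\<^sup>*\<^bsub>H\<^esub> point x"
      and y: "y < 2 * r - 1" "point y \<notin> S" "point y \<rightarrow>\<^sup>*\<^bsub>H\<^esub> v"
      using from_vertex to_vertex by (metis DiffD1 DiffD2 verts_H)
    note x(3)
    also have "point x \<rightarrow>\<^sup>*\<^bsub>H\<^esub> point y"
      using x y by (intro points)
    also note y(3)
    finally show "u \<rightarrow>\<^sup>*\<^bsub>H\<^esub> v" .
  qed
  then show ?thesis
    by (simp add: H_def)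
qed

section \<open>The two global properties: \<open>r\<close>-strong and eulerian\<close>

lemma r_strong_block_digraph: "r > 0 \<Longrightarrow> r_strong r (block_digraph r)"
  by (simp add: r_strong_def card_block_verts strongly_connected_delete)

text \<open>Connectedness comes from the deletion result with \<open>S = {}\<close>, which requires
  \<open>r > 0\<close>.\<close>

lemma eulerian_block_digraph:
  assumes "r > 0"
  shows "eulerian (block_digraph r)"
proof -
  interpret D: digraph "block_digraph r"
    by (rule digraph_block_digraph)
  have "block_digraph r \<restriction> block_verts r = block_digraph r"
    using block_arcs_subset by (force intro!: pre_digraph.equality)
  then have "strongly_connected (block_digraph r)"
    using strongly_connected_delete [of "{}" r] assms by simp
  then have "connected (block_digraph r)"
    by (simp add: connected_def strongly_connected_def D.reachable_mk_symmetricI)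
  then show ?thesis
    by (simp add: eulerian_def in_degree_eq_out_degree)
qed

section \<open>Colourings\<close>

text \<open>A path from \<open>v\<close> to another vertex \<open>w\<close> has a first arc, and a
  path back has a last one; both change colour. Since the parts are disjoint, membership in
  \<open>V1\<close> alone records the colour.\<close>

lemma strong_2_partition_neighbours:
  assumes part: "strong_2_partition D V1 V2" and v: "v \<in> verts D" and w: "w \<in> verts D" "w \<noteq> v"
  shows "\<exists>a\<in>arcs D. tail D a = v \<and> (head D a \<in> V1 \<longleftrightarrow> v \<notin> V1)"
    and "\<exists>a\<in>arcs D. head D a = v \<and> (tail D a \<in> V1 \<longleftrightarrow> v \<notin> V1)"
proof -
  let ?B = "bipartite_subdigraph D V1 V2"
  have disj: "V1 \<inter> V2 = {}" and strong: "v \<rightarrow>\<^sup>*\<^bsub>?B\<^esub> w" "w \<rightarrow>\<^sup>*\<^bsub>?B\<^esub> v"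
    using part v w by (auto simp: strong_2_partition_def strongly_connected_def bipartite_subdigraph_def)
  from strong(1) obtain u where "(v, u) \<in> arcs_ends ?B"
    using w(2) by (auto elim: pre_digraph.converse_reachable_cases)
  then show "\<exists>a\<in>arcs D. tail D a = v \<and> (head D a \<in> V1 \<longleftrightarrow> v \<notin> V1)"
    using disj by (auto simp: arcs_ends_conv bipartite_subdigraph_def)
  from strong(2) obtain u where "(u, v) \<in> arcs_ends ?B"
    using w(2) unfolding reachable_def by (auto elim: rtrancl_on.cases)
  then show "\<exists>a\<in>arcs D. head D a = v \<and> (tail D a \<in> V1 \<longleftrightarrow> v \<notin> V1)"
    using disj by (auto simp: arcs_ends_conv bipartite_subdigraph_def)
qed

text \<open>One of two colour classes on \<open>2 * r - 1\<close> points has at least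
  \<open>r\<close> elements, so it contains a block.\<close>

lemma ex_monochromatic_block:
  obtains e c where "e \<in> blocks r" "\<And>x. x \<in> set_decode e \<Longrightarrow> Q x \<longleftrightarrow> c"
proof -
  let ?X = "{..<2 * r - 1}"
  have "card {x \<in> ?X. Q x} + card {x \<in> ?X. \<not> Q x} = card ?X"
    by (subst card_Un_disjoint [symmetric]) (auto intro!: arg_cong [where f = card] simp del: card_lessThan)
  then have "r \<le> card {x \<in> ?X. Q x} \<or> r \<le> card {x \<in> ?X. \<not> Q x}"
    by auto
  \<comment> \<open>Writing both classes as \<open>Q x \<longleftrightarrow> c\<close> lets one
    colour variable \<open>c\<close> cover both cases.\<close>
  then have "r \<le> card {x \<in> ?X. Q x \<longleftrightarrow> True} \<or> r \<le> card {x \<in> ?X. Q x \<longleftrightarrow> False}"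
    by simp
  then obtain c where c: "r \<le> card {x \<in> ?X. Q x \<longleftrightarrow> c}"
    by (elim disjE)
  obtain e where "e \<in> blocks r" "set_decode e \<subseteq> {x \<in> ?X. Q x \<longleftrightarrow> c}"
    using c ex_block [of "{}" "{x \<in> ?X. Q x \<longleftrightarrow> c}" r] by auto
  then show ?thesis
    by (intro that [of e c]) auto
qed

lemma no_strong_2_partition:
  assumes "r > 0"
  shows "\<not> strong_2_partition (block_digraph r) V1 V2"
proof
  assume part: "strong_2_partition (block_digraph r) V1 V2"
  obtain e c where e: "e \<in> blocks r" and mono: "\<And>x. x \<in> set_decode e \<Longrightarrow> point x \<in> V1 \<longleftrightarrow> c"
    using ex_monochromatic_block [of r "\<lambda>x. point x \<in> V1"] by blast
  \<comment> \<open>Serves as the second vertex \<open>w\<close>, distinct from every hub and port;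
    it exists because \<open>r > 0\<close>.\<close>
  have point0: "point 0 \<in> verts (block_digraph r)"
    using assms by auto
  \<comment> \<open>All out-neighbours of a port are points of \<open>e\<close>, which have colour
    \<open>c\<close>.\<close>
  have port: "port e i \<in> V1 \<longleftrightarrow> \<not> c" if i: "i \<in> set_decode e" for i
  proof -
    obtain a where "a \<in> block_arcs r" "fst a = port e i" "snd a \<in> V1 \<longleftrightarrow> port e i \<notin> V1"
      using strong_2_partition_neighbours(1) [OF part _ point0, of "port e i"] e i
      by (auto simp: verts_intros)
    then show ?thesis
      using mono by (auto simp: block_arcs_def)
  qed
  \<comment> \<open>The out-neighbours of the hub are ports and its in-neighbours are points, so the
    two directions force opposite colours on it.\<close>
  obtain a where "a \<in> block_arcs r" "fst a = hub e" "snd a \<in> V1 \<longleftrightarrow> hub e \<notin> V1"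
    using strong_2_partition_neighbours(1) [OF part _ point0, of "hub e"] e
    by (auto simp: verts_intros)
  then have "hub e \<in> V1 \<longleftrightarrow> c"
    using port by (auto simp: block_arcs_def)
  moreover obtain b where "b \<in> block_arcs r" "snd b = hub e" "fst b \<in> V1 \<longleftrightarrow> hub e \<notin> V1"
    using strong_2_partition_neighbours(2) [OF part _ point0, of "hub e"] e
    by (auto simp: verts_intros)
  then have "hub e \<in> V1 \<longleftrightarrow> \<not> c"
    using mono by (auto simp: block_arcs_def)
  ultimately show False
    by blast
qed

theorem theorem7p1:
  fixes r :: nat
  assumes "r > 0"
  shows "\<exists>D :: (nat, nat \<times> nat) pre_digraph.
           digraph D \<and> r_strong r D \<and> eulerian D \<and>
           \<not> (\<exists>V1 V2. strong_2_partition D V1 V2)"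
  using assms
  by (intro exI [of _ "block_digraph r"])
    (simp add: digraph_block_digraph r_strong_block_digraph eulerian_block_digraph no_strong_2_partition)

end
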